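(* Let $\Gamma$ be a simply-laced Carter diagram realized by linearly independent roots $\tau_1,\dots,\tau_l$ of a finite root system $\varPhi$ spanning the space $E$ with symmetric bilinear form $(\cdot,\cdot)$ (given by the Cartan matrix ${\bf B}$ of $\varPhi$) and associated quadratic form $\mathscr{B}(v)=(v,v)$. Let $L=\mathrm{span}(\tau_1,\dots,\tau_l)$ and let $B_L$ be the partial Cartan matrix of $\Gamma$, with associated bilinear form $(\cdot,\cdot)_L$ and quadratic form $\mathscr{B}_L$ on $L$. 1) The restriction to $L$ of the bilinear form associated with ${\bf B}$ coincides with the bilinear form associated with $B_L$: for all $u,v\in L$, $(v,u)_L=(v,u)$ and $\mathscr{B}_L(v)=\mathscr{B}(v)$. 2) For every Carter diagram, the matrix $B_L$ is positive definite.
   Context: Root systems are finite and simply-laced with $(\alpha,\alpha)=2$ for every root. A simply-laced Carter diagram is a graph with solid/dotted edges, all of whose cycles have even length, realized by linearly independent (not necessarily simple) roots $\tau_1,\dots,\tau_l$ with $(\tau_i,\tau_j)=-1$ (solid), $+1$ (dotted), $0$ (no edge). The partial Cartan matrix is $B_L=((\tau_i,\tau_j))_{1\le i,j\le l}$; $(v,u)_L={}^t[v]B_L[u]$, where $[v],[u]$ are the coordinate vectors in the basis $\tau_1,\dots,\tau_l$ of $L$, and $\mathscr{B}_L(v)=(v,v)_L$. *)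

theory Defs
  imports "HOL-Analysis.Analysis"
begin

section \<open>Matrices of bilinear forms\<close>

definition independent_family :: "('i \<Rightarrow> 'a::real_vector) \<Rightarrow> bool" where
  "independent_family b \<longleftrightarrow> inj b \<and> independent (range b)"

definition coords :: "('i::finite \<Rightarrow> 'a::real_vector) \<Rightarrow> 'a \<Rightarrow> real ^ 'i" where
  "coords b v = (\<chi> i. representation (range b) v (b i))"

text \<open>The form with matrix \<open>M\<close> in the basis \<open>b\<close>, that is \<open>(v, u) = [v]\<^sup>t M [u]\<close>.
  It is meaningful only for an independent family \<open>b\<close> and for \<open>v, u\<close> in its span;
  outside the span \<^const>\<open>representation\<close> is 0.\<close>

definition matrix_form ::
  "('i::finite \<Rightarrow> 'a::real_vector) \<Rightarrow> real ^ 'i ^ 'i \<Rightarrow> 'a \<Rightarrow> 'a \<Rightarrow> real" where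
  "matrix_form b M v u = coords b v \<bullet> (M *v coords b u)"

definition quadratic_form :: "('a \<Rightarrow> 'a \<Rightarrow> real) \<Rightarrow> 'a \<Rightarrow> real" where
  "quadratic_form F v = F v v"

definition positive_definite :: "real ^ 'i ^ 'i::finite \<Rightarrow> bool" where
  "positive_definite M \<longleftrightarrow> transpose M = M \<and> (\<forall>x. x \<noteq> 0 \<longrightarrow> 0 < x \<bullet> (M *v x))"

section \<open>Root systems\<close>

definition root_system :: "'a::euclidean_space set \<Rightarrow> bool" where
  "root_system \<Phi> \<longleftrightarrow>
     finite \<Phi> \<and> 0 \<notin> \<Phi> \<and> span \<Phi> = UNIV \<and>
     (\<forall>\<alpha>\<in>\<Phi>. \<forall>c. c *\<^sub>R \<alpha> \<in> \<Phi> \<longrightarrow> c = 1 \<or> c = - 1) \<and>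
     (\<forall>\<alpha>\<in>\<Phi>. \<forall>\<beta>\<in>\<Phi>. \<beta> - (2 * (\<beta> \<bullet> \<alpha>) / (\<alpha> \<bullet> \<alpha>)) *\<^sub>R \<alpha> \<in> \<Phi>) \<and>
     (\<forall>\<alpha>\<in>\<Phi>. \<forall>\<beta>\<in>\<Phi>. 2 * (\<beta> \<bullet> \<alpha>) / (\<alpha> \<bullet> \<alpha>) \<in> \<int>)"

text \<open>The roots of a simply-laced system are normalized to squared length 2.\<close>

definition simply_laced :: "'a::euclidean_space set \<Rightarrow> bool" where
  "simply_laced \<Phi> \<longleftrightarrow> (\<forall>\<alpha>\<in>\<Phi>. \<alpha> \<bullet> \<alpha> = 2)"

definition simple_roots :: "'a::euclidean_space set \<Rightarrow> ('n::finite \<Rightarrow> 'a) \<Rightarrow> bool" where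
  "simple_roots \<Phi> \<alpha> \<longleftrightarrow>
     range \<alpha> \<subseteq> \<Phi> \<and> independent_family \<alpha> \<and>
     (\<forall>\<beta>\<in>\<Phi>. \<exists>c :: 'n \<Rightarrow> nat.
        \<beta> = (\<Sum>i\<in>UNIV. real (c i) *\<^sub>R \<alpha> i) \<or> \<beta> = - (\<Sum>i\<in>UNIV. real (c i) *\<^sub>R \<alpha> i))"

definition cartan_matrix :: "('n::finite \<Rightarrow> 'a::euclidean_space) \<Rightarrow> real ^ 'n ^ 'n" where
  "cartan_matrix \<alpha> = (\<chi> i j. 2 * (\<alpha> i \<bullet> \<alpha> j) / (\<alpha> j \<bullet> \<alpha> j))"

definition cartan_form :: "('n::finite \<Rightarrow> 'a::euclidean_space) \<Rightarrow> 'a \<Rightarrow> 'a \<Rightarrow> real" where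
  "cartan_form \<alpha> = matrix_form \<alpha> (cartan_matrix \<alpha>)"

section \<open>Carter diagrams\<close>

record 'l signed_graph =
  solid :: "'l \<Rightarrow> 'l \<Rightarrow> bool"
  dotted :: "'l \<Rightarrow> 'l \<Rightarrow> bool"

definition edge :: "'l signed_graph \<Rightarrow> 'l \<Rightarrow> 'l \<Rightarrow> bool" where
  "edge \<Gamma> i j \<longleftrightarrow> solid \<Gamma> i j \<or> dotted \<Gamma> i j"

definition simple_signed_graph :: "'l signed_graph \<Rightarrow> bool" where
  "simple_signed_graph \<Gamma> \<longleftrightarrow>
     symp (solid \<Gamma>) \<and> symp (dotted \<Gamma>) \<and> irreflp (edge \<Gamma>) \<and>
     (\<forall>i j. \<not> (solid \<Gamma> i j \<and> dotted \<Gamma> i j))"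

text \<open>A cycle is given by the list of its distinct vertices, in cyclic order; the last vertex is
  joined to the first one.\<close>

definition is_cycle :: "'l signed_graph \<Rightarrow> 'l list \<Rightarrow> bool" where
  "is_cycle \<Gamma> c \<longleftrightarrow>
     3 \<le> length c \<and> distinct c \<and>
     (\<forall>k < length c. edge \<Gamma> (c ! k) (c ! (Suc k mod length c)))"

text \<open>\<open>carter_diagram \<Phi> F \<Gamma> \<tau>\<close>: the graph \<open>\<Gamma>\<close> is a simply-laced Carter diagram
  realized by the roots \<open>\<tau> i\<close> of \<open>\<Phi>\<close>, where \<open>F\<close> is the bilinear form on the space of
  \<open>\<Phi>\<close>.\<close>

definition carter_diagram ::
  "'a::euclidean_space set \<Rightarrow> ('a \<Rightarrow> 'a \<Rightarrow> real) \<Rightarrow> 'l::finite signed_graph \<Rightarrow> ('l \<Rightarrow> 'a) \<Rightarrow> bool" where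
  "carter_diagram \<Phi> F \<Gamma> \<tau> \<longleftrightarrow>
     simple_signed_graph \<Gamma> \<and> (\<forall>c. is_cycle \<Gamma> c \<longrightarrow> even (length c)) \<and>
     range \<tau> \<subseteq> \<Phi> \<and> independent_family \<tau> \<and>
     (\<forall>i j. solid \<Gamma> i j \<longrightarrow> F (\<tau> i) (\<tau> j) = - 1) \<and>
     (\<forall>i j. dotted \<Gamma> i j \<longrightarrow> F (\<tau> i) (\<tau> j) = 1) \<and>
     (\<forall>i j. i \<noteq> j \<longrightarrow> \<not> edge \<Gamma> i j \<longrightarrow> F (\<tau> i) (\<tau> j) = 0)"

definition partial_cartan_matrix ::
  "('a \<Rightarrow> 'a \<Rightarrow> real) \<Rightarrow> ('l::finite \<Rightarrow> 'a) \<Rightarrow> real ^ 'l ^ 'l" where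
  "partial_cartan_matrix F \<tau> = (\<chi> i j. F (\<tau> i) (\<tau> j))"

end

theory Submission
  imports Defs
begin

text \<open>Simple roots span the whole space and have squared length 2, so the Cartan matrix is their
  Gram matrix and the form it defines is the ambient inner product. The matrix \<open>B\<^sub>L\<close> is then the
  Gram matrix of the independent family \<open>\<tau>\<close>, so it represents the inner product on the span of
  \<open>\<tau>\<close>, and \<open>x \<bullet> B\<^sub>L x\<close> is the squared length of the vector with coordinates \<open>x\<close>.\<close>

lemma sum_coords:
  fixes b :: "'i::finite \<Rightarrow> 'a::real_vector"
  assumes "independent_family b" and "v \<in> span (range b)"
  shows "(\<Sum>i\<in>UNIV. coords b v $ i *\<^sub>R b i) = v"
proof -
  have b: "inj b" "independent (range b)"
    using assms(1) by (auto simp: independent_family_def)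
  \<comment> \<open>Injectivity of \<open>b\<close> makes each vector of \<open>range b\<close>
    occur for exactly one index, so the sum over indices is a sum over the set.\<close>
  have "(\<Sum>i\<in>UNIV. coords b v $ i *\<^sub>R b i) = (\<Sum>w\<in>range b. representation (range b) v w *\<^sub>R w)"
    by (simp add: sum.reindex b(1) coords_def)
  also have "\<dots> = v"
    by (rule real_vector.sum_representation_eq) (use b(2) assms(2) in auto)
  finally show ?thesis .
qed

lemma independent_family_sum_eq_0D:
  fixes b :: "'i::finite \<Rightarrow> 'a::real_vector"
  assumes "independent_family b" and "(\<Sum>i\<in>UNIV. x $ i *\<^sub>R b i) = 0"
  shows "x = 0"
proof -
  have b: "inj b" "independent (range b)"
    using assms(1) by (auto simp: independent_family_def)
  \<comment> \<open>\<open>independent\<close> speaks of a set of vectors, so \<open>inv b\<close>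
    moves the coefficients from indices to vectors.\<close>
  have "(\<Sum>w\<in>range b. (x $ inv b w) *\<^sub>R w) = 0"
    using assms(2) by (simp add: sum.reindex b(1))
  then have "x $ inv b (b i) = 0" for i
    using real_vector.independentD[OF b(2), of "range b" "\<lambda>w. x $ inv b w" "b i"] by simp
  then show ?thesis
    by (simp add: vec_eq_iff b(1))
qed

text \<open>Bilinearity turns both sides into the same double sum, up to the order of summation.
  This reduces the values of the form and its positivity to statements about vectors.\<close>

lemma partial_cartan_matrix_sum:
  fixes b :: "'i::finite \<Rightarrow> 'a::real_inner"
  shows "x \<bullet> (partial_cartan_matrix (\<bullet>) b *v y) =
    (\<Sum>i\<in>UNIV. x $ i *\<^sub>R b i) \<bullet> (\<Sum>i\<in>UNIV. y $ i *\<^sub>R b i)"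
  by (simp add: partial_cartan_matrix_def inner_vec_def matrix_vector_mult_def
      inner_sum_left inner_sum_right sum_distrib_left mult_ac) (rule sum.swap)

lemma matrix_form_partial_cartan_matrix:
  fixes b :: "'i::finite \<Rightarrow> 'a::real_inner"
  assumes "independent_family b" and "v \<in> span (range b)" and "u \<in> span (range b)"
  shows "matrix_form b (partial_cartan_matrix (\<bullet>) b) v u = v \<bullet> u"
  by (simp add: matrix_form_def partial_cartan_matrix_sum sum_coords assms)

lemma positive_definite_partial_cartan_matrix:
  fixes b :: "'i::finite \<Rightarrow> 'a::real_inner"
  assumes "independent_family b"
  shows "positive_definite (partial_cartan_matrix (\<bullet>) b)"
  unfolding positive_definite_def
proof (intro conjI allI impI)
  show "transpose (partial_cartan_matrix (\<bullet>) b) = partial_cartan_matrix (\<bullet>) b"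
    by (simp add: partial_cartan_matrix_def transpose_def inner_commute)
  show "0 < x \<bullet> (partial_cartan_matrix (\<bullet>) b *v x)" if "x \<noteq> 0" for x
    \<comment> \<open>A squared length vanishes only at the zero vector, and independence keeps the
      combination with coefficients \<open>x\<close> away from it.\<close>
    using independent_family_sum_eq_0D[OF assms, of x] that
    by (auto simp: partial_cartan_matrix_sum)
qed

text \<open>Each root is, up to sign, a combination of simple roots, and the roots span the
  space.\<close>

lemma span_simple_roots:
  fixes \<Phi> :: "'a::euclidean_space set"
  assumes "root_system \<Phi>" and "simple_roots \<Phi> \<alpha>"
  shows "span (range \<alpha>) = UNIV"
proof -
  have sum: "(\<Sum>i\<in>UNIV. real (c i) *\<^sub>R \<alpha> i) \<in> span (range \<alpha>)" for c
    by (intro span_sum span_scale span_base) auto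
  have "\<Phi> \<subseteq> span (range \<alpha>)"
  proof
    fix \<beta> assume "\<beta> \<in> \<Phi>"
    then obtain c where "\<beta> = (\<Sum>i\<in>UNIV. real (c i) *\<^sub>R \<alpha> i) \<or> \<beta> = - (\<Sum>i\<in>UNIV. real (c i) *\<^sub>R \<alpha> i)"
      using assms(2) unfolding simple_roots_def by blast
    then show "\<beta> \<in> span (range \<alpha>)"
      using sum[of c] by (auto intro: span_neg)
  qed
  then have "span \<Phi> \<subseteq> span (range \<alpha>)"
    by (simp add: span_minimal)
  then show ?thesis
    using assms(1) by (auto simp: root_system_def)
qed

lemma cartan_form_eq_inner:
  fixes \<Phi> :: "'a::euclidean_space set"
  assumes "root_system \<Phi>" and "simply_laced \<Phi>" and "simple_roots \<Phi> \<alpha>"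
  shows "cartan_form \<alpha> = (\<bullet>)"
proof (intro ext)
  fix v u
  have "\<alpha> i \<bullet> \<alpha> i = 2" for i
    using assms(2,3) by (auto simp: simply_laced_def simple_roots_def)
  then have "cartan_matrix \<alpha> = partial_cartan_matrix (\<bullet>) \<alpha>"
    by (simp add: cartan_matrix_def partial_cartan_matrix_def)
  then show "cartan_form \<alpha> v u = v \<bullet> u"
    \<comment> \<open>Coordinates default to 0 outside the span, so equality at all \<open>v\<close>
      and \<open>u\<close> relies on the simple roots spanning everything.\<close>
    using assms(3) span_simple_roots[OF assms(1,3)]
    by (simp add: cartan_form_def matrix_form_partial_cartan_matrix simple_roots_def)
qed

theorem proposition2p4:
  fixes \<Phi> :: "'a::euclidean_space set"
    and \<alpha> :: "'n::finite \<Rightarrow> 'a"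
    and \<Gamma> :: "'l::finite signed_graph"
    and \<tau> :: "'l \<Rightarrow> 'a"
  defines "B \<equiv> cartan_form \<alpha>"
    and "B\<^sub>L \<equiv> partial_cartan_matrix (cartan_form \<alpha>) \<tau>"
  assumes "root_system \<Phi>" and "simply_laced \<Phi>" and "simple_roots \<Phi> \<alpha>"
    and "carter_diagram \<Phi> B \<Gamma> \<tau>"
  shows "(\<forall>u \<in> span (range \<tau>). \<forall>v \<in> span (range \<tau>).
            matrix_form \<tau> B\<^sub>L v u = B v u \<and>
            quadratic_form (matrix_form \<tau> B\<^sub>L) v = quadratic_form B v)
         \<and> positive_definite B\<^sub>L"
proof -
  have "independent_family \<tau>"
    using assms(6) by (simp add: carter_diagram_def)
  then show ?thesis
    \<comment> \<open>Once the Cartan form is replaced by the inner product,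
      \<open>B\<^sub>L\<close> is literally the Gram matrix of \<tau>.\<close>
    unfolding B_def B\<^sub>L_def cartan_form_eq_inner[OF assms(3-5)]
    by (simp add: quadratic_form_def matrix_form_partial_cartan_matrix
        positive_definite_partial_cartan_matrix)
qed

end
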